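(* For any $\epsilon>0$, there is a real number $D=D(\epsilon)$ such that $g_d(n)=O(d^{(2+\epsilon)n})$ for every fixed integer $d\geq D$.
   Context: A finite set $P$ of (distinct, labelled) points in $\mathbb{R}^d$ is in general position if no $d+1$ of its points lie on the same hyperplane. A peeling sequence of $P$ is the sequence of labels obtained by the following process: in each step remove exactly one vertex of the convex hull of the current remaining point set and write down its label; repeat until all points of $P$ have been removed. For $P$ in general position in $\mathbb{R}^d$, $g_d(P)$ denotes the number of different peeling sequences of $P$, and $g_d(n)=\min_{|P|=n} g_d(P)$, where the minimum is taken over all $n$-element point sets $P$ in general position in $\mathbb{R}^d$. The $O$-notation refers to $n\to\infty$ with $d$ and $\epsilon$ fixed. *)

theory Defs
  imports "HOL-Analysis.Analysis" "HOL-Analysis.Finite_Function_Topology" "HOL-Library.Landau_Symbols"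
begin

text \<open>
  The dimension d is quantified inside the asymptotic statement and therefore cannot be a type.
  We realise R^d as the d-dimensional coordinate subspace of the real vector space of finitely
  supported functions on the naturals; convex hulls and extreme points are then the library's.
\<close>

definition Rn :: "nat \<Rightarrow> (nat \<Rightarrow>\<^sub>0 real) set" where
  "Rn d = {x. \<forall>i\<ge>d. Poly_Mapping.lookup x i = 0}"

definition hyperplane :: "nat \<Rightarrow> (nat \<Rightarrow>\<^sub>0 real) set \<Rightarrow> bool" where
  "hyperplane d H \<longleftrightarrow>
     (\<exists>(a :: nat \<Rightarrow> real) (b :: real). (\<exists>i<d. a i \<noteq> 0) \<and>
        H = {x \<in> Rn d. (\<Sum>i<d. a i * Poly_Mapping.lookup x i) = b})"

definition general_position :: "nat \<Rightarrow> (nat \<Rightarrow>\<^sub>0 real) set \<Rightarrow> bool" where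
  "general_position d P \<longleftrightarrow>
     finite P \<and> P \<subseteq> Rn d \<and>
     \<not> (\<exists>H Q. hyperplane d H \<and> Q \<subseteq> P \<and> card Q = d + 1 \<and> Q \<subseteq> H)"

text \<open>
  Labels are distinct, so each point serves as its own label. A vertex of the convex hull of a
  finite set is an extreme point of it.
\<close>

inductive peeling_sequence :: "'a::real_vector set \<Rightarrow> 'a list \<Rightarrow> bool" where
  Nil: "peeling_sequence {} []"
| Cons: "p \<in> P \<Longrightarrow> p extreme_point_of (convex hull P) \<Longrightarrow> peeling_sequence (P - {p}) ps
    \<Longrightarrow> peeling_sequence P (p # ps)"

definition num_peelings :: "'a::real_vector set \<Rightarrow> nat" where
  "num_peelings P = card {ps. peeling_sequence P ps}"

text \<open>
  On the naturals, the infimum of a nonempty set is its minimum; for positive d the set below is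
  nonempty, see \<open>general_position_exists\<close>.
\<close>

definition min_peelings :: "nat \<Rightarrow> nat \<Rightarrow> nat" where
  "min_peelings d n = Inf {num_peelings P | P. general_position d P \<and> card P = n}"

lemma peeling_sequence_set: "peeling_sequence P ps \<Longrightarrow> distinct ps \<and> set ps = P"
  by (induction rule: peeling_sequence.induct) auto

lemma finite_peeling_sequences:
  assumes "finite P"
  shows "finite {ps. peeling_sequence P ps}"
proof (rule finite_subset)
  show "{ps. peeling_sequence P ps} \<subseteq> {ps. set ps \<subseteq> P \<and> length ps \<le> card P}"
    by (auto dest!: peeling_sequence_set simp: distinct_card)
  show "finite {ps. set ps \<subseteq> P \<and> length ps \<le> card P}"
    by (rule finite_lists_length_le[OF assms])
qed

text \<open>Points on the moment curve are in general position.\<close>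

lemma general_position_exists:
  assumes "d \<ge> 1"
  shows "\<exists>P. general_position d P \<and> card P = n"
proof -
  define m :: "real \<Rightarrow> nat \<Rightarrow>\<^sub>0 real"
    where "m t = Abs_poly_mapping (\<lambda>i. if i < d then t ^ Suc i else 0)" for t
  have lookup_m: "Poly_Mapping.lookup (m t) i = (if i < d then t ^ Suc i else 0)" for t i
    unfolding m_def by (subst lookup_Abs_poly_mapping) auto
  have inj: "inj m"
  proof (rule injI)
    fix s t assume "m s = m t"
    then have "Poly_Mapping.lookup (m s) 0 = Poly_Mapping.lookup (m t) 0" by simp
    with assms show "s = t" by (simp add: lookup_m)
  qed
  define P where "P = (\<lambda>k. m (real k)) ` {..<n}"
  have "inj_on (\<lambda>k. m (real k)) {..<n}"
    by (rule inj_onI) (metis inj injD of_nat_eq_iff)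
  then have "card P = n" by (simp add: P_def card_image)
  moreover have "general_position d P"
    unfolding general_position_def
  proof (intro conjI notI)
    show "finite P" by (simp add: P_def)
    show "P \<subseteq> Rn d" by (auto simp: P_def Rn_def lookup_m)
    assume "\<exists>H Q. hyperplane d H \<and> Q \<subseteq> P \<and> card Q = d + 1 \<and> Q \<subseteq> H"
    then obtain H Q where H: "hyperplane d H" and Q: "Q \<subseteq> P" "card Q = d + 1" "Q \<subseteq> H"
      by blast
    from H obtain a b i where i: "i < d" "a i \<noteq> (0::real)"
      and H_eq: "H = {x \<in> Rn d. (\<Sum>i<d. a i * Poly_Mapping.lookup x i) = b}"
      unfolding hyperplane_def by (elim exE conjE)
    have on: "(\<Sum>i<d. a i * Poly_Mapping.lookup x i) = b" if "x \<in> Q" for x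
      using that Q(3) by (auto simp: H_eq)
    define c where "c j = (case j of 0 \<Rightarrow> - b | Suc l \<Rightarrow> a l)" for j
    let ?Z = "{z. (\<Sum>j\<le>d. c j * z ^ j) = 0}"
    have Z: "finite ?Z" "card ?Z \<le> d"
      using Transcendental.polyfun_rootbound[of c "Suc i" d] i by (auto simp: c_def)
    have "Q \<subseteq> m ` ?Z"
    proof
      fix x assume x: "x \<in> Q"
      with Q(1) obtain t where t: "x = m t" by (auto simp: P_def)
      have "(\<Sum>j\<le>d. c j * t ^ j) = - b + (\<Sum>l<d. a l * t ^ Suc l)"
        by (simp add: lessThan_Suc_atMost[symmetric] sum.lessThan_Suc_shift c_def
            del: sum.lessThan_Suc)
      also have "\<dots> = 0" using on[OF x] by (simp add: t lookup_m)
      finally show "x \<in> m ` ?Z" using t by auto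
    qed
    then have "card Q \<le> card ?Z"
      using Z by (meson card_image_le card_mono finite_imageI le_trans)
    with Q(2) Z(2) show False by simp
  qed
  ultimately show ?thesis by blast
qed

end

theory Submission
  imports Defs "Jordan_Normal_Form.Determinant"
begin

text \<open>
  The points are placed on \<open>q = 2Kd\<close> arms, each close to one of \<open>q\<close> rays from the origin. The rays are
  chosen so that every open half-space through the origin contains almost half of them: at most
  \<open>E = Kd + d\<close> of them miss it. As long as more than \<open>E\<close> arms are nonempty, the origin is therefore
  inside the hull of the outermost points, and so is every point that is not the outermost one of its
  arm; hence there are at most \<open>q\<close> choices per step. Once only \<open>E\<close> arms are left, nothing is claimed
  about which of their points can be peeled, except that the peeling order induces a peeling order on
  each arm. An arm is a flattened affine copy of a good configuration with \<open>n / q\<close> points. If \<open>G n\<close>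
  denotes the number of orders, this gives
  \<open>G n \<le> q\<^sup>n * G (n / q) ^ E\<close> (\<open>achievable_arms\<close>), because a word over the arms together with
  one order for each of at most \<open>E\<close> arms determines the sequence. With \<open>G n \<approx> exp (a n)\<close>, the rate
  satisfies \<open>a \<le> ln q + (E / q) a\<close>, so it can be pushed down to \<open>ln q / (1 - E / q)\<close>
  (\<open>growth_above_fixpoint\<close>). Here \<open>E / q = 1/2 + 1/(2K)\<close> and \<open>ln q = ln d + ln (2K)\<close>; for large \<open>K\<close>,
  and then large \<open>d\<close>, the bound is below \<open>(2 + \<epsilon>) ln d\<close>.

  The recursion runs on degenerate configurations. For this, extremality is relaxed to the condition that some
  nonzero functional is weakly maximised (\<open>removable\<close>); for a finite set this says that the point is
  not in the interior of the hull of the others. By compactness of the sphere of functionals this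
  condition is closed, so a small perturbation of a configuration can only lose removable points
  (\<open>removable_stable\<close>). Degenerate configurations such as points exactly on the rays may therefore
  be used, and a perturbation into general position (\<open>general_position_near\<close>) comes at the end.

  Points of the recursion are functions \<open>nat \<Rightarrow> real\<close> of which only the first \<open>d\<close> coordinates count,
  and the set to be peeled is a set of indices.
\<close>

section \<open>Counting removal orders\<close>

text \<open>
  The number of ways to empty \<open>S\<close> one element at a time when \<open>r R x\<close> says that \<open>x\<close> may be removed
  from the current set \<open>R\<close>. Infinite sets get the default value 1.
\<close>

function num_orders :: "('a set \<Rightarrow> 'a \<Rightarrow> bool) \<Rightarrow> 'a set \<Rightarrow> nat" where
  "num_orders r S = (if finite S \<and> S \<noteq> {} then \<Sum>x | x \<in> S \<and> r S x. num_orders r (S - {x}) else 1)"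
  by auto
termination
  by (relation "Wellfounded.measure (card \<circ> snd)") (auto simp: card_gt_0_iff intro!: card_Diff1_less)

declare num_orders.simps [simp del]

lemma num_orders_empty [simp]: "num_orders r {} = 1"
  by (simp add: num_orders.simps)

lemma num_orders_rec:
  assumes "finite S" "S \<noteq> {}"
  shows "num_orders r S = (\<Sum>x | x \<in> S \<and> r S x. num_orders r (S - {x}))"
  using assms by (subst num_orders.simps) simp

text \<open>
  Carries bounds along perturbations (\<open>f\<close> the identity, \<open>r\<close> stronger than \<open>r'\<close>) and along
  reindexing.
\<close>

lemma num_orders_transfer:
  assumes "finite S" "inj_on f S"
    and "\<And>R x. R \<subseteq> S \<Longrightarrow> x \<in> R \<Longrightarrow> r R x \<Longrightarrow> r' (f ` R) (f x)"
  shows "num_orders r S \<le> num_orders r' (f ` S)"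
  using assms
proof (induction S rule: finite_psubset_induct)
  case (psubset S)
  show ?case
  proof (cases "S = {}")
    case False
    have "num_orders r S = (\<Sum>x | x \<in> S \<and> r S x. num_orders r (S - {x}))"
      using psubset.hyps False by (rule num_orders_rec)
    also have "\<dots> \<le> (\<Sum>x | x \<in> S \<and> r S x. num_orders r' (f ` S - {f x}))"
    proof (rule sum_mono)
      fix x assume x: "x \<in> {x. x \<in> S \<and> r S x}"
      have "num_orders r (S - {x}) \<le> num_orders r' (f ` (S - {x}))"
        using x psubset.prems by (intro psubset.IH) (auto intro: inj_on_subset)
      also have "f ` (S - {x}) = f ` S - {f x}"
        using x psubset.prems(1) by (auto dest: inj_onD)
      finally show "num_orders r (S - {x}) \<le> num_orders r' (f ` S - {f x})" .
    qed
    also have "\<dots> = (\<Sum>y\<in>f ` {x. x \<in> S \<and> r S x}. num_orders r' (f ` S - {y}))"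
      using psubset.prems(1) by (subst sum.reindex) (auto intro: inj_on_subset)
    also have "\<dots> \<le> (\<Sum>y | y \<in> f ` S \<and> r' (f ` S) y. num_orders r' (f ` S - {y}))"
      using psubset by (intro sum_mono2) auto
    also have "\<dots> = num_orders r' (f ` S)"
      using psubset.hyps False by (intro num_orders_rec[symmetric]) auto
    finally show ?thesis .
  qed simp
qed

lemma num_orders_le_power:
  assumes "finite S" "card S \<le> n"
  shows "num_orders r S \<le> n ^ card S"
  using assms
proof (induction S rule: finite_psubset_induct)
  case (psubset S)
  show ?case
  proof (cases "S = {}")
    case False
    have "num_orders r S = (\<Sum>x | x \<in> S \<and> r S x. num_orders r (S - {x}))"
      using psubset.hyps False by (rule num_orders_rec)
    also have "\<dots> \<le> (\<Sum>x | x \<in> S \<and> r S x. n ^ (card S - 1))"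
    proof (rule sum_mono)
      fix x assume "x \<in> {x. x \<in> S \<and> r S x}"
      then have "S - {x} \<subset> S" "card (S - {x}) = card S - 1"
        using psubset.hyps by auto
      then show "num_orders r (S - {x}) \<le> n ^ (card S - 1)"
        using psubset.IH[of "S - {x}"] psubset.prems by simp
    qed
    also have "\<dots> \<le> card S * n ^ (card S - 1)"
      using psubset.hyps by (auto intro!: mult_right_mono card_mono)
    also have "\<dots> \<le> n * n ^ (card S - 1)"
      using psubset.prems by (intro mult_right_mono) auto
    also have "\<dots> = n ^ card S"
      using psubset.hyps False by (simp add: power_eq_if)
    finally show ?thesis .
  qed simp
qed

lemma num_peelings_le_orders:
  assumes "finite P"
  shows "num_peelings P \<le> num_orders (\<lambda>R x. x extreme_point_of (convex hull R)) P"
  using assms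
proof (induction P rule: finite_psubset_induct)
  case (psubset P)
  let ?L = "\<lambda>P. {ps. peeling_sequence P ps}"
  let ?E = "{p. p \<in> P \<and> p extreme_point_of (convex hull P)}"
  show ?case
  proof (cases "P = {}")
    case True
    have "?L P = {[]}"
      unfolding True by (auto intro: peeling_sequence.intros elim: peeling_sequence.cases)
    then show ?thesis
      by (simp add: num_peelings_def True)
  next
    case False
    have "?L P \<subseteq> (\<Union>p\<in>?E. (#) p ` ?L (P - {p}))"
      using False by (auto elim: peeling_sequence.cases)
    then have "card (?L P) \<le> card (\<Union>p\<in>?E. (#) p ` ?L (P - {p}))"
      using psubset.hyps by (intro card_mono) (auto intro!: finite_peeling_sequences)
    also have "\<dots> \<le> (\<Sum>p\<in>?E. card ((#) p ` ?L (P - {p})))"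
      using psubset.hyps by (intro card_UN_le) auto
    also have "\<dots> \<le> (\<Sum>p\<in>?E. num_peelings (P - {p}))"
      unfolding num_peelings_def using psubset.hyps
      by (intro sum_mono card_image_le) (auto intro!: finite_peeling_sequences)
    also have "\<dots> \<le> (\<Sum>p\<in>?E. num_orders (\<lambda>R x. x extreme_point_of (convex hull R)) (P - {p}))"
      by (intro sum_mono psubset.IH) auto
    also have "\<dots> = num_orders (\<lambda>R x. x extreme_point_of (convex hull R)) P"
      using psubset.hyps False by (intro num_orders_rec[symmetric])
    finally show ?thesis
      by (simp add: num_peelings_def)
  qed
qed

text \<open>
  An order is determined by the word of the arms from which it removes, together with the orders that
  it induces on the single arms. These are admissible on the arms because \<open>r\<close> is inherited by subsets.
\<close>

lemma num_orders_le_prod: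
  fixes arm :: "'a \<Rightarrow> nat"
  assumes "finite S" "arm ` S \<subseteq> {..<q}"
    and hered: "\<And>R T x. R \<subseteq> S \<Longrightarrow> T \<subseteq> R \<Longrightarrow> x \<in> T \<Longrightarrow> r R x \<Longrightarrow> r T x"
  shows "num_orders r S \<le> q ^ card S * (\<Prod>i<q. num_orders r {x \<in> S. arm x = i})"
  using assms
proof (induction S rule: finite_psubset_induct)
  case (psubset S)
  let ?A = "\<lambda>i. {x \<in> S. arm x = i}"
  let ?G = "\<Prod>i<q. num_orders r (?A i)"
  show ?case
  proof (cases "S = {}")
    case False
    have arm_sum: "(\<Sum>x | x \<in> ?A i \<and> r S x. num_orders r (S - {x})) \<le> q ^ (card S - 1) * ?G"
      if i: "i < q" for i
    proof -
      let ?rest = "\<Prod>j\<in>{..<q}-{i}. num_orders r (?A j)"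
      have "(\<Sum>x | x \<in> ?A i \<and> r S x. num_orders r (S - {x}))
          \<le> (\<Sum>x | x \<in> ?A i \<and> r S x. q ^ (card S - 1) * ?rest * num_orders r (?A i - {x}))"
      proof (rule sum_mono)
        fix x assume x: "x \<in> {x. x \<in> ?A i \<and> r S x}"
        have "num_orders r (S - {x}) \<le> q ^ card (S - {x}) * (\<Prod>j<q. num_orders r {y \<in> S - {x}. arm y = j})"
        proof (rule psubset.IH)
          show "r T z" if "R \<subseteq> S - {x}" "T \<subseteq> R" "z \<in> T" "r R z" for R T z
            by (rule psubset.prems(2)[of R]) (use that in auto)
          show "S - {x} \<subset> S" "arm ` (S - {x}) \<subseteq> {..<q}"
            using x psubset.prems(1) by auto
        qed
        also have "(\<Prod>j<q. num_orders r {y \<in> S - {x}. arm y = j})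
            = num_orders r {y \<in> S - {x}. arm y = i} * (\<Prod>j\<in>{..<q}-{i}. num_orders r {y \<in> S - {x}. arm y = j})"
          using i by (subst prod.remove[of _ i]) auto
        also have "{y \<in> S - {x}. arm y = i} = ?A i - {x}"
          by auto
        also have "(\<Prod>j\<in>{..<q}-{i}. num_orders r {y \<in> S - {x}. arm y = j}) = ?rest"
          using x by (intro prod.cong arg_cong[where f = "num_orders r"]) auto
        finally show "num_orders r (S - {x}) \<le> q ^ (card S - 1) * ?rest * num_orders r (?A i - {x})"
          using x psubset.hyps by (simp add: mult_ac)
      qed
      also have "\<dots> = q ^ (card S - 1) * ?rest * (\<Sum>x | x \<in> ?A i \<and> r S x. num_orders r (?A i - {x}))"
        by (rule sum_distrib_left[symmetric])
      also have "(\<Sum>x | x \<in> ?A i \<and> r S x. num_orders r (?A i - {x})) \<le> num_orders r (?A i)"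
      proof (cases "?A i = {}")
        case False
        have "(\<Sum>x | x \<in> ?A i \<and> r S x. num_orders r (?A i - {x}))
            \<le> (\<Sum>x | x \<in> ?A i \<and> r (?A i) x. num_orders r (?A i - {x}))"
          using psubset.hyps psubset.prems(2)[of S "?A i"] by (intro sum_mono2) auto
        also have "\<dots> = num_orders r (?A i)"
          using psubset.hyps False by (intro num_orders_rec[symmetric]) auto
        finally show ?thesis .
      next
        case True
        then have "{x. x \<in> ?A i \<and> r S x} = {}" by blast
        then show ?thesis by (simp only: sum.empty)
      qed
      also have "q ^ (card S - 1) * ?rest * num_orders r (?A i) = q ^ (card S - 1) * ?G"
        using i by (simp add: prod.remove[of "{..<q}" i] mult_ac)
      finally show ?thesis by simp
    qed
    have "num_orders r S = (\<Sum>x | x \<in> S \<and> r S x. num_orders r (S - {x}))"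
      using psubset.hyps False by (rule num_orders_rec)
    also have "\<dots> = (\<Sum>i<q. \<Sum>x | x \<in> {x. x \<in> S \<and> r S x} \<and> arm x = i. num_orders r (S - {x}))"
      using psubset.hyps psubset.prems(1) by (intro sum.group[symmetric]) auto
    also have "\<dots> \<le> (\<Sum>i<q. q ^ (card S - 1) * ?G)"
    proof (rule sum_mono)
      fix i assume i: "i \<in> {..<q}"
      have "{x. x \<in> {x. x \<in> S \<and> r S x} \<and> arm x = i} = {x. x \<in> ?A i \<and> r S x}"
        by auto
      then show "(\<Sum>x | x \<in> {x. x \<in> S \<and> r S x} \<and> arm x = i. num_orders r (S - {x})) \<le> q ^ (card S - 1) * ?G"
        using arm_sum[of i] i by simp
    qed
    also have "\<dots> = q ^ card S * ?G"
      using psubset.hyps False by (simp add: power_eq_if)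
    finally show ?thesis .
  qed simp
qed

text \<open>
  The two phases of a removal. While more than \<open>E\<close> arms are nonempty, the arm determines the removed
  element and each step costs a factor \<open>q\<close>. At the first moment with at most \<open>E\<close> nonempty arms,
  the previous lemma applies, and every empty arm contributes a factor 1 instead of \<open>B\<close>. To make the
  second phase independent of what is left of an arm, the bound \<open>B\<close> is required for all subsets of
  an arm.
\<close>

lemma num_orders_le_arms:
  fixes arm :: "'a \<Rightarrow> nat"
  assumes "finite S" "arm ` S \<subseteq> {..<q}" "B \<ge> 1"
    and hered: "\<And>R T x. R \<subseteq> S \<Longrightarrow> T \<subseteq> R \<Longrightarrow> x \<in> T \<Longrightarrow> r R x \<Longrightarrow> r T x"
    and arm_le: "\<And>i T. T \<subseteq> {x \<in> S. arm x = i} \<Longrightarrow> num_orders r T \<le> B"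
    and single: "\<And>R x y. R \<subseteq> S \<Longrightarrow> card (arm ` R) > E \<Longrightarrow> x \<in> R \<Longrightarrow> y \<in> R \<Longrightarrow>
      r R x \<Longrightarrow> r R y \<Longrightarrow> arm x = arm y \<Longrightarrow> x = y"
  shows "num_orders r S \<le> q ^ card S * B ^ E"
  using assms
proof (induction S rule: finite_psubset_induct)
  case (psubset S)
  show ?case
  proof (cases "card (arm ` S) > E")
    case True
    then have ne: "S \<noteq> {}" by auto
    let ?X = "{x. x \<in> S \<and> r S x}"
    have "inj_on arm ?X"
      using psubset.prems(5)[OF subset_refl True] by (auto intro!: inj_onI)
    then have "card ?X \<le> card {..<q}"
      using psubset.prems(1) by (intro card_inj_on_le[of arm]) auto
    have "num_orders r S = (\<Sum>x\<in>?X. num_orders r (S - {x}))"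
      using psubset.hyps ne by (rule num_orders_rec)
    also have "\<dots> \<le> (\<Sum>x\<in>?X. q ^ (card S - 1) * B ^ E)"
    proof (rule sum_mono)
      fix x assume x: "x \<in> ?X"
      have "num_orders r (S - {x}) \<le> q ^ card (S - {x}) * B ^ E"
      proof (rule psubset.IH)
        show "num_orders r T \<le> B" if "T \<subseteq> {y \<in> S - {x}. arm y = i}" for T i
          by (rule psubset.prems(4)[of _ i]) (use that in auto)
        show "r T z" if "R \<subseteq> S - {x}" "T \<subseteq> R" "z \<in> T" "r R z" for R T z
          by (rule psubset.prems(3)[of R]) (use that in auto)
        show "y = z" if "R \<subseteq> S - {x}" "card (arm ` R) > E" "y \<in> R" "z \<in> R" "r R y" "r R z"
            "arm y = arm z" for R y z
          by (rule psubset.prems(5)[of R]) (use that in auto)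
        show "S - {x} \<subset> S" "arm ` (S - {x}) \<subseteq> {..<q}" "B \<ge> 1"
          using x psubset.prems(1,2) by auto
      qed
      then show "num_orders r (S - {x}) \<le> q ^ (card S - 1) * B ^ E"
        using x psubset.hyps by simp
    qed
    also have "\<dots> \<le> q * (q ^ (card S - 1) * B ^ E)"
      using \<open>card ?X \<le> card {..<q}\<close> by (auto intro!: mult_right_mono)
    also have "\<dots> = q ^ card S * B ^ E"
      using psubset.hyps ne by (simp add: power_eq_if)
    finally show ?thesis .
  next
    case False
    have "(\<Prod>i<q. num_orders r {x \<in> S. arm x = i}) = (\<Prod>i\<in>arm ` S. num_orders r {x \<in> S. arm x = i})"
    proof (rule prod.mono_neutral_right)
      have "num_orders r {x \<in> S. arm x = i} = 1" if "i \<notin> arm ` S" for i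
      proof -
        have "{x \<in> S. arm x = i} = {}" using that by auto
        then show ?thesis by (simp only: num_orders_empty)
      qed
      then show "\<forall>i\<in>{..<q} - arm ` S. num_orders r {x \<in> S. arm x = i} = 1"
        by blast
    qed (use psubset.prems(1) in auto)
    also have "\<dots> \<le> (\<Prod>i\<in>arm ` S. B)"
      by (intro prod_mono) (auto intro: psubset.prems(4))
    also have "\<dots> \<le> B ^ E"
      using False psubset.prems(2) by (auto intro!: power_increasing)
    finally have "q ^ card S * (\<Prod>i<q. num_orders r {x \<in> S. arm x = i}) \<le> q ^ card S * B ^ E"
      by simp
    moreover have "num_orders r S \<le> q ^ card S * (\<Prod>i<q. num_orders r {x \<in> S. arm x = i})"
      using psubset.hyps psubset.prems(1) by (rule num_orders_le_prod) (rule psubset.prems(3))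
    ultimately show ?thesis by (rule order_trans[rotated])
  qed
qed

section \<open>A relaxation of extremality that survives perturbation\<close>

definition dot :: "nat \<Rightarrow> (nat \<Rightarrow> real) \<Rightarrow> (nat \<Rightarrow> real) \<Rightarrow> real" where
  "dot d a x = (\<Sum>i<d. a i * x i)"

definition removable :: "nat \<Rightarrow> ('a \<Rightarrow> nat \<Rightarrow> real) \<Rightarrow> 'a set \<Rightarrow> 'a \<Rightarrow> bool" where
  "removable d p R x \<longleftrightarrow>
     (\<exists>a. (\<exists>i<d. a i \<noteq> 0) \<and> (\<forall>y\<in>R. dot d a (p y) \<le> dot d a (p x)))"

lemma removable_antimono: "removable d p R x \<Longrightarrow> T \<subseteq> R \<Longrightarrow> removable d p T x"
  unfolding removable_def by blast

lemma lookup_scaleR_real: "Poly_Mapping.lookup (r *\<^sub>R x) i = r * Poly_Mapping.lookup x i"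
  for x :: "'a \<Rightarrow>\<^sub>0 real"
proof -
  have "finite {i. r * Poly_Mapping.lookup x i \<noteq> 0}"
    by (rule finite_subset[OF _ finite_lookup[of x]]) auto
  then show ?thesis
    by (simp add: scaleR_poly_mapping_def)
qed

lemma continuous_on_lookup: "continuous_on A (\<lambda>x. Poly_Mapping.lookup x i)"
  for A :: "('a \<Rightarrow>\<^sub>0 real) set"
proof -
  have "norm (Poly_Mapping.lookup x i) \<le> norm x" for x :: "'a \<Rightarrow>\<^sub>0 real"
  proof (cases "i \<in> Poly_Mapping.keys x")
    case True
    then show ?thesis
      by (auto simp: norm_poly_mapping_def dist_poly_mapping_def
          intro!: member_le_sum[of i "Poly_Mapping.keys x" "\<lambda>i. \<bar>Poly_Mapping.lookup x i\<bar>"])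
  next
    case False
    then show ?thesis by (simp add: in_keys_iff)
  qed
  then have "bounded_linear (\<lambda>x :: 'a \<Rightarrow>\<^sub>0 real. Poly_Mapping.lookup x i)"
    by (intro bounded_linear_intro[where K = 1]) (auto simp: lookup_add lookup_scaleR_real)
  then show ?thesis
    by (rule linear_continuous_on)
qed

lemma nonpos_of_quadratic_bound:
  fixes b c :: real
  assumes "\<And>t. 0 < t \<Longrightarrow> t \<le> 1 \<Longrightarrow> 2 * t * b \<le> t\<^sup>2 * c"
  shows "b \<le> 0"
proof (rule ccontr)
  assume b: "\<not> b \<le> 0"
  define t where "t = b / (b + \<bar>c\<bar>)"
  have t: "0 < t" "t \<le> 1" using b by (auto simp: t_def field_simps)
  have "2 * b \<le> t * c"
    using assms[OF t] t by (simp add: power2_eq_square)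
  also have "\<dots> \<le> t * (b + \<bar>c\<bar>)" using t b by (intro mult_left_mono) auto
  also have "\<dots> = b" using b by (simp add: t_def)
  finally show False using b by simp
qed

text \<open>
  An extreme point \<open>x\<close> is outside the hull of the other points. The difference between \<open>x\<close> and the
  point of that hull which is nearest in the coordinates below \<open>d\<close> is a separating functional. The norm
  of the ambient space is an \<open>l\<^sup>1\<close> norm, so the nearest point is found for the Euclidean distance by
  hand; the norm topology only serves for compactness.
\<close>

lemma extreme_point_removable:
  fixes P :: "(nat \<Rightarrow>\<^sub>0 real) set"
  assumes "finite P" "P \<subseteq> Rn d" "d \<ge> 1" and x: "x \<in> P" "x extreme_point_of (convex hull P)"
  shows "removable d Poly_Mapping.lookup P x"
proof -
  let ?T = "P - {x}" and ?l = "Poly_Mapping.lookup :: _ \<Rightarrow> nat \<Rightarrow> real"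
  have notin: "x \<notin> convex hull ?T"
  proof
    assume *: "x \<in> convex hull ?T"
    then have "convex hull (insert x ?T) = convex hull ?T"
      by (rule hull_redundant)
    then have "x extreme_point_of (convex hull ?T)"
      using x by (simp add: insert_absorb)
    then show False
      using extreme_point_of_convex_hull by blast
  qed
  show ?thesis
  proof (cases "?T = {}")
    case True
    then show ?thesis
      using \<open>d \<ge> 1\<close> unfolding removable_def by (intro exI[of _ "\<lambda>_. 1"]) (auto intro: exI[of _ 0])
  next
    case False
    define f where "f y = (\<Sum>i<d. (?l x i - ?l y i)\<^sup>2)" for y
    have "compact (convex hull ?T)"
      using assms(1) by (intro finite_imp_compact_convex_hull) auto
    moreover have "convex hull ?T \<noteq> {}"
      using False by simp
    moreover have "continuous_on (convex hull ?T) f"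
      unfolding f_def by (intro continuous_intros continuous_on_lookup)
    ultimately obtain y0 where y0: "y0 \<in> convex hull ?T" "\<And>y. y \<in> convex hull ?T \<Longrightarrow> f y0 \<le> f y"
      using continuous_attains_inf[of "convex hull ?T" f] by blast
    define a where "a i = ?l x i - ?l y0 i" for i
    have "convex (Rn d :: (nat \<Rightarrow>\<^sub>0 real) set)"
      by (auto simp: convex_def Rn_def lookup_add lookup_scaleR_real)
    then have "convex hull ?T \<subseteq> Rn d"
      using assms(2) by (intro hull_minimal) auto
    then have Rn: "y0 \<in> Rn d" "x \<in> Rn d"
      using y0 x assms(2) by auto
    have "\<exists>i<d. a i \<noteq> 0"
    proof (rule ccontr)
      assume "\<not> (\<exists>i<d. a i \<noteq> 0)"
      then have "?l x i = ?l y0 i" for i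
        using Rn by (cases "i < d") (auto simp: a_def Rn_def)
      then have "x = y0" by (rule poly_mapping_eqI)
      then show False using notin y0 by simp
    qed
    moreover have "dot d a (?l y) \<le> dot d a (?l x)" if y: "y \<in> P" for y
    proof (cases "y = x")
      case False
      define w where "w i = ?l y i - ?l y0 i" for i
      have "dot d a w \<le> 0"
      proof (rule nonpos_of_quadratic_bound)
        fix t :: real assume t: "0 < t" "t \<le> 1"
        have "y \<in> convex hull ?T"
          using y False by (intro hull_inc) auto
        then have "(1 - t) *\<^sub>R y0 + t *\<^sub>R y \<in> convex hull ?T"
          using y0(1) t by (intro convexD convex_convex_hull) auto
        then have "f y0 \<le> f ((1 - t) *\<^sub>R y0 + t *\<^sub>R y)" by (rule y0)
        also have "\<dots> = (\<Sum>i<d. (?l x i - ((1 - t) * ?l y0 i + t * ?l y i))\<^sup>2)"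
          by (simp add: f_def lookup_add lookup_scaleR_real)
        also have "\<dots> = (\<Sum>i<d. (a i - t * w i)\<^sup>2)"
          by (simp add: a_def w_def algebra_simps)
        also have "\<dots> = f y0 - 2 * t * dot d a w + t\<^sup>2 * dot d w w"
          by (simp add: f_def a_def[symmetric] dot_def power2_eq_square algebra_simps
              sum.distrib sum_subtractf sum_distrib_left)
        finally show "2 * t * dot d a w \<le> t\<^sup>2 * dot d w w" by simp
      qed
      moreover have "dot d a w = dot d a (?l y) - dot d a (?l y0)"
        by (simp add: dot_def w_def right_diff_distrib sum_subtractf)
      moreover have "dot d a (?l x) - dot d a (?l y0) = dot d a a"
        by (simp add: dot_def a_def sum_subtractf[symmetric] algebra_simps)
      moreover have "dot d a a \<ge> 0"
        by (auto simp: dot_def intro!: sum_nonneg)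
      ultimately show ?thesis by linarith
    qed simp
    ultimately show ?thesis
      unfolding removable_def by blast
  qed
qed

text \<open>
  If \<open>x\<close> is not removable, each normalised functional takes on some point of \<open>R\<close> a larger value
  than on \<open>x\<close>. The total excess \<open>\<phi>\<close> is continuous and positive on the compact set \<open>A\<close> of these
  functionals, hence bounded below, and a perturbation of size \<open>\<eta>\<close> changes it by at most
  \<open>2 \<eta>\<close> per point.
\<close>

lemma not_removable_open:
  assumes "finite R" "x \<in> R" "\<not> removable d p R x"
  shows "\<forall>\<^sub>F \<eta> in at_right 0. \<forall>p'. (\<forall>y\<in>R. \<forall>i<d. \<bar>p' y i - p y i\<bar> < \<eta>) \<longrightarrow> \<not> removable d p' R x"
proof -
  define A where "A = PiE UNIV (\<lambda>i. if i < d then {-1..1} else {0 :: real}) \<inter> {a. (\<Sum>i<d. \<bar>a i\<bar>) = 1}"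
  define \<phi> where "\<phi> a = (\<Sum>y\<in>R. max 0 (dot d a (p y) - dot d a (p x)))" for a
  have "compactin (product_topology (\<lambda>_. euclidean) UNIV)
      (PiE UNIV (\<lambda>i. if i < d then {-1..1} else {0 :: real}))"
    by (subst compactin_PiE) auto
  then have "compact (PiE UNIV (\<lambda>i. if i < d then {-1..1} else {0 :: real}))"
    by (simp add: euclidean_product_topology)
  moreover have "closed {a :: nat \<Rightarrow> real. (\<Sum>i<d. \<bar>a i\<bar>) = 1}"
    by (intro closed_Collect_eq continuous_intros) auto
  ultimately have "compact A"
    unfolding A_def by (rule compact_Int_closed)
  have dot_cont: "continuous_on A (\<lambda>a. dot d a z)" for z
    unfolding dot_def by (intro continuous_intros) (auto intro: continuous_on_subset[OF continuous_on_product_coordinates])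
  have cont: "continuous_on A \<phi>"
    unfolding \<phi>_def by (intro continuous_intros dot_cont)
  have nonzero: "\<exists>i<d. a i \<noteq> 0" if "a \<in> A" for a
  proof (rule ccontr)
    assume "\<not> (\<exists>i<d. a i \<noteq> 0)"
    then have "(\<Sum>i<d. \<bar>a i\<bar>) = 0" by simp
    then show False using that by (simp add: A_def)
  qed
  have pos: "\<phi> a > 0" if a: "a \<in> A" for a
  proof -
    obtain y where y: "y \<in> R" "dot d a (p y) > dot d a (p x)"
      using assms(3) nonzero[OF a] unfolding removable_def by (meson not_le)
    then show ?thesis
      unfolding \<phi>_def by (intro sum_pos2[OF assms(1) y(1)]) auto
  qed
  obtain \<rho> where \<rho>: "\<rho> > 0" "\<And>a. a \<in> A \<Longrightarrow> \<rho> \<le> \<phi> a"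
  proof (cases "A = {}")
    case True
    then show ?thesis by (intro that[of 1]) auto
  next
    case False
    then show ?thesis
      using continuous_attains_inf[OF \<open>compact A\<close> False cont] pos that by blast
  qed
  have "\<forall>\<^sub>F \<eta> in at_right 0. real (card R) * (2 * \<eta>) < \<rho>"
    using \<rho>(1) by (intro order_tendstoD(2)[of _ 0]) (auto intro!: tendsto_eq_intros)
  then show ?thesis
  proof (rule eventually_mono, intro allI impI notI)
    fix \<eta> p' assume \<eta>: "real (card R) * (2 * \<eta>) < \<rho>"
      and close: "\<forall>y\<in>R. \<forall>i<d. \<bar>p' y i - p y i\<bar> < \<eta>" and "removable d p' R x"
    then obtain b where b: "\<exists>i<d. b i \<noteq> 0" "\<And>y. y \<in> R \<Longrightarrow> dot d b (p' y) \<le> dot d b (p' x)"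
      unfolding removable_def by blast
    define s where "s = (\<Sum>i<d. \<bar>b i\<bar>)"
    have "s > 0"
      using b(1) unfolding s_def by (auto intro: sum_pos2)
    define a where "a i = (if i < d then b i / s else 0)" for i
    have sum1: "(\<Sum>i<d. \<bar>a i\<bar>) = 1"
      using \<open>s > 0\<close> by (simp add: a_def s_def sum_divide_distrib[symmetric])
    have "a i \<in> (if i < d then {-1..1} else {0})" for i
    proof (cases "i < d")
      case True
      then have "\<bar>a i\<bar> \<le> 1"
        using member_le_sum[of i "{..<d}" "\<lambda>i. \<bar>a i\<bar>"] sum1 by simp
      then show ?thesis using True by (simp add: abs_le_iff)
    qed (simp add: a_def)
    then have "a \<in> A"
      using sum1 unfolding A_def by blast
    have dot_a: "dot d a z = dot d b z / s" for z
      by (simp add: dot_def a_def sum_divide_distrib)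
    have near: "\<bar>dot d a (p' y) - dot d a (p y)\<bar> \<le> \<eta>" if "y \<in> R" for y
    proof -
      have "\<bar>dot d a (p' y) - dot d a (p y)\<bar> = \<bar>\<Sum>i<d. a i * (p' y i - p y i)\<bar>"
        by (simp add: dot_def sum_subtractf right_diff_distrib)
      also have "\<dots> \<le> (\<Sum>i<d. \<bar>a i\<bar> * \<eta>)"
        using close that by (intro order_trans[OF sum_abs] sum_mono) (auto simp: abs_mult intro!: mult_left_mono intro: less_imp_le)
      also have "\<dots> = \<eta>"
        by (simp add: sum_distrib_right[symmetric] sum1)
      finally show ?thesis .
    qed
    have "0 \<le> \<eta>" using near[OF assms(2)] by linarith
    have "\<phi> a \<le> (\<Sum>y\<in>R. 2 * \<eta>)"
      unfolding \<phi>_def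
    proof (rule sum_mono)
      fix y assume y: "y \<in> R"
      have "dot d a (p' y) \<le> dot d a (p' x)"
        using b(2)[OF y] \<open>s > 0\<close> by (simp add: dot_a divide_right_mono)
      then show "max 0 (dot d a (p y) - dot d a (p x)) \<le> 2 * \<eta>"
        using near[OF y] near[OF assms(2)] \<open>0 \<le> \<eta>\<close> by (auto simp: abs_le_iff)
    qed
    also have "\<dots> < \<rho>" using \<eta> by simp
    finally show False using \<rho>(2)[OF \<open>a \<in> A\<close>] by simp
  qed
qed

lemma removable_stable:
  fixes p :: "'a \<Rightarrow> nat \<Rightarrow> real"
  assumes "finite I"
  shows "\<exists>\<eta>>0. \<forall>p' R x. (\<forall>y\<in>I. \<forall>i<d. \<bar>p' y i - p y i\<bar> < \<eta>) \<longrightarrow> R \<subseteq> I \<longrightarrow> x \<in> R \<longrightarrow>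
    removable d p' R x \<longrightarrow> removable d p R x"
proof -
  define ok where "ok \<eta> R x \<longleftrightarrow>
    (\<forall>p'. (\<forall>y\<in>R. \<forall>i<d. \<bar>p' y i - p y i\<bar> < \<eta>) \<longrightarrow> \<not> removable d p' R x)" for \<eta> R x
  have "\<forall>\<^sub>F \<eta> in at_right 0. \<not> removable d p R x \<longrightarrow> ok \<eta> R x" if "R \<subseteq> I" "x \<in> R" for R x
    unfolding ok_def using not_removable_open[of R x d p] that assms
    by (cases "removable d p R x") (auto dest: finite_subset)
  then have "\<forall>\<^sub>F \<eta> in at_right 0. \<forall>R\<in>Pow I. \<forall>x\<in>R. \<not> removable d p R x \<longrightarrow> ok \<eta> R x"
    using assms by (intro eventually_ball_finite ballI) (auto dest: finite_subset)
  then have "\<forall>\<^sub>F \<eta> in at_right 0. \<eta> > 0 \<and> (\<forall>R\<in>Pow I. \<forall>x\<in>R. \<not> removable d p R x \<longrightarrow> ok \<eta> R x)"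
    by (intro eventually_conj eventually_at_right_less)
  from eventually_happens'[OF trivial_limit_at_right_real this]
  obtain \<eta> where "\<eta> > 0" and \<eta>: "\<forall>R\<in>Pow I. \<forall>x\<in>R. \<not> removable d p R x \<longrightarrow> ok \<eta> R x"
    by blast
  show ?thesis
  proof (intro exI[of _ \<eta>] conjI allI impI, fact, rule ccontr)
    fix p' R x
    assume *: "\<forall>y\<in>I. \<forall>i<d. \<bar>p' y i - p y i\<bar> < \<eta>" "R \<subseteq> I" "x \<in> R"
      "removable d p' R x" "\<not> removable d p R x"
    have "\<forall>y\<in>R. \<forall>i<d. \<bar>p' y i - p y i\<bar> < \<eta>" using *(1,2) by auto
    moreover have "ok \<eta> R x" using * \<eta> by simp
    ultimately show False using *(4) unfolding ok_def by blast
  qed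
qed

section \<open>Rays of which every open half-space contains almost half\<close>

text \<open>
  Points of the moment curve, with alternating signs. A functional evaluates on these to
  \<open>(-1)\<^sup>i f(i)\<close> for a polynomial \<open>f\<close> of degree less than \<open>d\<close>.
\<close>

definition ray :: "nat \<Rightarrow> nat \<Rightarrow> real" where
  "ray i l = (-1) ^ i * real i ^ l"

text \<open>
  On a pair \<open>2j, 2j + 1\<close> without a root of \<open>f\<close> in between, \<open>f\<close> keeps its sign, so the functional
  is positive on exactly one of the two rays. The intervals of different pairs are disjoint, so
  at most \<open>d\<close> pairs are affected by a root.
\<close>

lemma card_ray_nonpos:
  assumes a: "\<exists>l<d. a l \<noteq> 0"
  shows "card {i. i < 2 * h \<and> dot d a (ray i) \<le> 0} \<le> h + d"
proof -
  define f where "f z = (\<Sum>l<d. a l * z ^ l)" for z :: real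
  have dot_f: "dot d a (ray i) = (-1) ^ i * f (real i)" for i
    by (simp add: dot_def ray_def f_def sum_distrib_left mult_ac)
  obtain k where k: "k < d" "a k \<noteq> 0" using a by blast
  define c where "c l = (if l < d then a l else 0)" for l
  have f_c: "f z = (\<Sum>l\<le>d. c l * z ^ l)" for z
    by (simp add: f_def c_def lessThan_Suc_atMost[symmetric])
  have roots: "finite {z. f z = 0}" "card {z. f z = 0} \<le> d"
    using Transcendental.polyfun_rootbound[of c k d] k by (auto simp: f_c c_def)
  \<comment> \<open>the pairs that are separated by a root, or contain one\<close>
  define bad where "bad = {j. j < h \<and> (\<exists>z. 2 * real j \<le> z \<and> z \<le> 2 * real j + 1 \<and> f z = 0)}"
  have "bad \<subseteq> (\<lambda>z. nat \<lfloor>z\<rfloor> div 2) ` {z. f z = 0}"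
  proof
    fix j assume "j \<in> bad"
    then obtain z where z: "2 * real j \<le> z" "z \<le> 2 * real j + 1" "f z = 0"
      by (auto simp: bad_def)
    then have "\<lfloor>z\<rfloor> = 2 * int j \<or> \<lfloor>z\<rfloor> = 2 * int j + 1" by linarith
    then have "j = nat \<lfloor>z\<rfloor> div 2" by auto
    then show "j \<in> (\<lambda>z. nat \<lfloor>z\<rfloor> div 2) ` {z. f z = 0}" using z(3) by blast
  qed
  then have "card bad \<le> card {z. f z = 0}"
    by (rule surj_card_le[OF roots(1)])
  then have card_bad: "card bad \<le> d" using roots(2) by simp
  define N where "N j = {i. (i = 2 * j \<or> i = Suc (2 * j)) \<and> dot d a (ray i) \<le> 0}" for j
  have N_le: "card (N j) \<le> (if j \<in> bad then 2 else 1)" if "j < h" for j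
  proof (cases "j \<in> bad")
    case True
    have "card (N j) \<le> card {2 * j, Suc (2 * j)}"
      by (intro card_mono) (auto simp: N_def)
    then show ?thesis using True by simp
  next
    case False
    have cont: "continuous_on S f" for S
      unfolding f_def by (intro continuous_intros)
    have no_root: "f z \<noteq> 0" if "2 * real j \<le> z" "z \<le> 2 * real j + 1" for z
      using False \<open>j < h\<close> that by (auto simp: bad_def)
    have "\<not> (f (2 * real j) \<le> 0 \<and> 0 \<le> f (2 * real j + 1))"
      using IVT'[of f "2 * real j" 0 "2 * real j + 1"] cont no_root by auto
    moreover have "\<not> (f (2 * real j + 1) \<le> 0 \<and> 0 \<le> f (2 * real j))"
      using IVT2'[of f "2 * real j + 1" 0 "2 * real j"] cont no_root by auto
    ultimately have "\<not> (2 * j \<in> N j \<and> Suc (2 * j) \<in> N j)"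
      by (auto simp: N_def dot_f add.commute)
    then have "N j \<subseteq> {2 * j} \<or> N j \<subseteq> {Suc (2 * j)}"
      by (auto simp: N_def)
    then have "card (N j) \<le> 1"
      using card_mono[of "{2 * j}" "N j"] card_mono[of "{Suc (2 * j)}" "N j"] by auto
    then show ?thesis using False by simp
  qed
  have "{i. i < 2 * h \<and> dot d a (ray i) \<le> 0} \<subseteq> (\<Union>j<h. N j)"
  proof
    fix i assume i: "i \<in> {i. i < 2 * h \<and> dot d a (ray i) \<le> 0}"
    then have "i div 2 < h" "i = 2 * (i div 2) \<or> i = Suc (2 * (i div 2))" by auto
    then show "i \<in> (\<Union>j<h. N j)" using i by (auto simp: N_def)
  qed
  moreover have "finite (N j)" for j
    by (rule finite_subset[of _ "{2 * j, Suc (2 * j)}"]) (auto simp: N_def)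
  ultimately have "card {i. i < 2 * h \<and> dot d a (ray i) \<le> 0} \<le> card (\<Union>j<h. N j)"
    by (intro card_mono) auto
  also have "\<dots> \<le> (\<Sum>j<h. card (N j))"
    by (rule card_UN_le) simp
  also have "\<dots> \<le> (\<Sum>j<h. 1 + (if j \<in> bad then 1 else 0))"
    by (intro sum_mono order_trans[OF N_le]) auto
  also have "\<dots> = h + card ({..<h} \<inter> bad)"
    by (subst sum.distrib) (simp add: sum.If_cases)
  also have "{..<h} \<inter> bad = bad"
    by (auto simp: bad_def)
  finally show ?thesis using card_bad by simp
qed

section \<open>Perturbation into general position\<close>

text \<open>
  The points move on lines towards distinct points of the moment curve. That \<open>d + 1\<close> of them lie
  on a common hyperplane is the vanishing of a determinant whose entries are affine in the time \<open>s\<close>.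
  It is a polynomial in \<open>s\<close>, and it does not vanish at \<open>s = 1\<close>, since the moment curve meets a
  hyperplane in at most \<open>d\<close> points.
\<close>

lemma finite_cohyperplanar_times:
  fixes p :: "nat \<Rightarrow> nat \<Rightarrow> real"
  assumes "card J = d + 1"
  shows "finite {s. \<exists>a b. (\<exists>i<d. a i \<noteq> 0) \<and>
    (\<forall>j\<in>J. (\<Sum>i<d. a i * ((1 - s) * p j i + s * real j ^ Suc i)) = b)}"
proof -
  have "finite J" using assms by (simp add: card_ge_0_finite)
  then obtain e where e: "bij_betw e {0..<d + 1} J"
    using ex_bij_betw_nat_finite[of J] assms by auto
  define A :: "real poly mat" where
    "A = mat (d + 1) (d + 1) (\<lambda>(k, l). if l = 0 then 1 else
       [: p (e k) (l - 1), real (e k) ^ l - p (e k) (l - 1) :])"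
  define M :: "real \<Rightarrow> real mat" where
    "M s = mat (d + 1) (d + 1) (\<lambda>(k, l). if l = 0 then 1 else
       (1 - s) * p (e k) (l - 1) + s * real (e k) ^ l)" for s
  have M: "M s \<in> carrier_mat (d + 1) (d + 1)" for s
    by (simp add: M_def)
  have "M s = map_mat (\<lambda>f. poly f s) A" for s
    by (rule eq_matI) (auto simp: M_def A_def algebra_simps)
  moreover have "det (map_mat (\<lambda>f. poly f s) A) = poly (det A) s" for s
  proof -
    interpret comm_ring_hom "\<lambda>f. poly f s"
      by unfold_locales auto
    show ?thesis by (rule hom_det)
  qed
  ultimately have det_M: "det (M s) = poly (det A) s" for s
    by simp
  have M_mult: "(M s *\<^sub>v v) $ k = v $ 0 + (\<Sum>i<d. v $ Suc i * ((1 - s) * p (e k) i + s * real (e k) ^ Suc i))"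
    if "v \<in> carrier_vec (d + 1)" "k < d + 1" for s v k
  proof -
    have "(M s *\<^sub>v v) $ k = (\<Sum>l<d + 1. (if l = 0 then 1 else
       (1 - s) * p (e k) (l - 1) + s * real (e k) ^ l) * v $ l)"
      using that by (auto simp: M_def scalar_prod_def atLeast0LessThan intro!: sum.cong)
    also have "\<dots> = v $ 0 + (\<Sum>i<d. v $ Suc i * ((1 - s) * p (e k) i + s * real (e k) ^ Suc i))"
      by (simp add: sum.lessThan_Suc_shift mult.commute del: sum.lessThan_Suc)
    finally show ?thesis .
  qed
  have "det (M 1) \<noteq> 0"
  proof
    assume "det (M 1) = 0"
    then obtain v where v: "v \<in> carrier_vec (d + 1)" "v \<noteq> 0\<^sub>v (d + 1)" "M 1 *\<^sub>v v = 0\<^sub>v (d + 1)"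
      using det_0_iff_vec_prod_zero[OF M] by blast
    then obtain l where l: "l \<le> d" "v $ l \<noteq> 0"
      by (metis carrier_vecD eq_vecI index_zero_vec less_Suc_eq_le Suc_eq_plus1)
    let ?Z = "{z. (\<Sum>l\<le>d. v $ l * z ^ l) = 0}"
    have Z: "finite ?Z" "card ?Z \<le> d"
      using Transcendental.polyfun_rootbound[of "\<lambda>l. v $ l" l d] l by auto
    have "real ` J \<subseteq> ?Z"
    proof
      fix z assume "z \<in> real ` J"
      then obtain k where k: "k < d + 1" "z = real (e k)"
        using e by (auto simp: bij_betw_def)
      have "(\<Sum>l\<le>d. v $ l * z ^ l) = (M 1 *\<^sub>v v) $ k"
        using M_mult[OF v(1) k(1), of 1] k(2)
        by (simp add: lessThan_Suc_atMost[symmetric] sum.lessThan_Suc_shift del: sum.lessThan_Suc)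
      then show "z \<in> ?Z" using v(3) k(1) by simp
    qed
    then have "card (real ` J) \<le> d"
      using card_mono[OF Z(1)] Z(2) by (meson le_trans)
    then show False
      using assms by (simp add: card_image)
  qed
  then have "det A \<noteq> 0"
    unfolding det_M by auto
  then have "finite {s. poly (det A) s = 0}"
    by (rule poly_roots_finite)
  moreover have "poly (det A) s = 0"
    if nz: "\<exists>i<d. a i \<noteq> 0" and on: "\<forall>j\<in>J. (\<Sum>i<d. a i * ((1 - s) * p j i + s * real j ^ Suc i)) = b" for s a b
  proof -
    define v where "v = vec (d + 1) (\<lambda>l. if l = 0 then - b else a (l - 1))"
    have v: "v \<in> carrier_vec (d + 1)" by (simp add: v_def)
    obtain i where i: "i < d" "a i \<noteq> 0" using nz by blast
    have "v $ Suc i \<noteq> 0\<^sub>v (d + 1) $ Suc i"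
      using i by (simp add: v_def)
    then have "v \<noteq> 0\<^sub>v (d + 1)" by metis
    moreover have "M s *\<^sub>v v = 0\<^sub>v (d + 1)"
    proof (rule eq_vecI)
      fix k assume "k < dim_vec (0\<^sub>v (d + 1) :: real vec)"
      then have k: "k < d + 1" by simp
      then have "e k \<in> J" using e by (auto simp: bij_betw_def)
      have "(\<Sum>i<d. v $ Suc i * ((1 - s) * p (e k) i + s * real (e k) ^ Suc i)) = b"
        using on \<open>e k \<in> J\<close> by (simp add: v_def)
      then show "(M s *\<^sub>v v) $ k = 0\<^sub>v (d + 1) $ k"
        unfolding M_mult[OF v k] using k by (simp add: v_def)
    qed (simp add: M_def)
    ultimately have "det (M s) = 0"
      using det_0_iff_vec_prod_zero[OF M] v by blast
    then show ?thesis by (simp add: det_M)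
  qed
  ultimately show ?thesis
    by (elim finite_subset[rotated]) auto
qed

text \<open>
  Besides the finitely many times of the previous lemma, a small \<open>s > 0\<close> has to avoid the times at which
  two first coordinates agree. Distinct first coordinates ensure that the points are distinct; they
  are also what the arm construction needs.
\<close>

lemma general_position_near:
  fixes p :: "nat \<Rightarrow> nat \<Rightarrow> real"
  assumes "d \<ge> 1" "\<eta> > 0"
  obtains f where "inj_on (\<lambda>j. Poly_Mapping.lookup (f j) 0) {..<n}" "general_position d (f ` {..<n})"
    "\<And>j i. j < n \<Longrightarrow> i < d \<Longrightarrow> \<bar>Poly_Mapping.lookup (f j) i - p j i\<bar> < \<eta>"
proof -
  let ?m = "\<lambda>s j i. (1 - s) * p j i + s * real j ^ Suc i"
  define Z1 where "Z1 = (\<Union>J\<in>{J. J \<subseteq> {..<n} \<and> card J = d + 1}.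
    {s. \<exists>a b. (\<exists>i<d. a i \<noteq> 0) \<and> (\<forall>j\<in>J. (\<Sum>i<d. a i * ?m s j i) = b)})"
  define Z2 where "Z2 = (\<Union>(j, k)\<in>{(j, k). j < n \<and> k < n \<and> j \<noteq> k}. {s. ?m s j 0 = ?m s k 0})"
  have "finite Z1"
    unfolding Z1_def by (intro finite_UN_I finite_subset[of "{J. J \<subseteq> {..<n} \<and> card J = d + 1}" "Pow {..<n}"]
        finite_cohyperplanar_times) auto
  moreover have "finite Z2"
    unfolding Z2_def
  proof (rule finite_UN_I)
    show "finite {(j, k). j < n \<and> k < n \<and> j \<noteq> k}"
      by (rule finite_subset[of _ "{..<n} \<times> {..<n}"]) auto
    fix z assume "z \<in> {(j, k). j < n \<and> k < n \<and> j \<noteq> k}"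
    then obtain j k where z: "z = (j, k)" "j \<noteq> k" by auto
    let ?f = "[: p j 0 - p k 0, real j - real k - (p j 0 - p k 0) :]"
    have "poly ?f 1 \<noteq> 0" using z by simp
    then have "?f \<noteq> 0" by (metis poly_0)
    then have "finite {s. poly ?f s = 0}" by (rule poly_roots_finite)
    then show "finite (case z of (j, k) \<Rightarrow> {s. ?m s j 0 = ?m s k 0})"
      by (rule rev_finite_subset) (auto simp: z algebra_simps)
  qed
  ultimately have "\<forall>\<^sub>F s in at_right (0::real). \<forall>z\<in>Z1 \<union> Z2. s \<noteq> z"
    by (intro eventually_ball_finite) (auto intro!: eventually_neq_at_within)
  moreover have "\<forall>\<^sub>F s in at_right (0::real). \<forall>(j, i)\<in>{..<n} \<times> {..<d}. \<bar>?m s j i - p j i\<bar> < \<eta>"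
  proof (rule eventually_ball_finite, safe)
    fix j i
    show "\<forall>\<^sub>F s in at_right (0::real). \<bar>?m s j i - p j i\<bar> < \<eta>"
      using assms(2) by (intro order_tendstoD(2)[of _ 0]) (auto intro!: tendsto_eq_intros)
  qed auto
  ultimately have "\<forall>\<^sub>F s in at_right (0::real). (\<forall>z\<in>Z1 \<union> Z2. s \<noteq> z) \<and>
      (\<forall>(j, i)\<in>{..<n} \<times> {..<d}. \<bar>?m s j i - p j i\<bar> < \<eta>)"
    by (rule eventually_conj)
  then obtain s where s: "s \<notin> Z1" "s \<notin> Z2" "\<And>j i. j < n \<Longrightarrow> i < d \<Longrightarrow> \<bar>?m s j i - p j i\<bar> < \<eta>"
    using eventually_happens'[OF trivial_limit_at_right_real] by (force split: prod.splits)
  define f where "f j = Abs_poly_mapping (\<lambda>i. if i < d then ?m s j i else 0)" for j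
  have lookup_f: "Poly_Mapping.lookup (f j) i = (if i < d then ?m s j i else 0)" for j i
    unfolding f_def by (subst lookup_Abs_poly_mapping) auto
  have inj0: "inj_on (\<lambda>j. Poly_Mapping.lookup (f j) 0) {..<n}"
    using s(2) assms(1) by (auto simp: inj_on_def Z2_def lookup_f)
  then have inj: "inj_on f {..<n}"
    by (auto simp: inj_on_def)
  have "general_position d (f ` {..<n})"
    unfolding general_position_def
  proof (intro conjI notI)
    show "f ` {..<n} \<subseteq> Rn d" by (auto simp: Rn_def lookup_f)
    assume "\<exists>H Q. hyperplane d H \<and> Q \<subseteq> f ` {..<n} \<and> card Q = d + 1 \<and> Q \<subseteq> H"
    then obtain H Q where H: "hyperplane d H" and Q: "Q \<subseteq> f ` {..<n}" "card Q = d + 1" "Q \<subseteq> H"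
      by blast
    then obtain J where J: "J \<subseteq> {..<n}" "Q = f ` J" by (meson subset_imageE)
    then have "card J = d + 1"
      using Q(2) inj by (metis card_image inj_on_subset)
    moreover obtain a b where "\<exists>i<d. a i \<noteq> 0" "H = {x \<in> Rn d. (\<Sum>i<d. a i * Poly_Mapping.lookup x i) = b}"
      using H unfolding hyperplane_def by blast
    moreover from this have "\<forall>j\<in>J. (\<Sum>i<d. a i * ?m s j i) = b"
      using Q(3) J(2) by (auto simp: lookup_f)
    ultimately have "s \<in> Z1"
      unfolding Z1_def using J(1) by blast
    then show False using s(1) by blast
  qed simp
  then show ?thesis
    using inj0 s(3) by (intro that[of f]) (auto simp: lookup_f)
qed

section \<open>The arm construction\<close>

text \<open>
  The bound is demanded of all subsets because the recursion applies it to whatever is left of an arm.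
\<close>

definition achievable :: "nat \<Rightarrow> nat \<Rightarrow> nat \<Rightarrow> bool" where
  "achievable d n B \<longleftrightarrow>
     (\<exists>p :: nat \<Rightarrow> nat \<Rightarrow> real. \<forall>S\<subseteq>{..<n}. num_orders (removable d p) S \<le> B)"

lemma achievable_mono: "achievable d n B \<Longrightarrow> n' \<le> n \<Longrightarrow> B \<le> B' \<Longrightarrow> achievable d n' B'"
  unfolding achievable_def by (meson lessThan_subset_iff order_trans)

lemma achievable_self_power: "achievable d n (n ^ n)"
  unfolding achievable_def
proof (intro exI allI impI)
  fix S assume S: "S \<subseteq> {..<n}"
  then have "finite S" "card S \<le> n"
    using finite_subset card_mono[OF _ S] by auto
  then have "num_orders (removable d p) S \<le> n ^ card S" for p :: "nat \<Rightarrow> nat \<Rightarrow> real"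
    by (rule num_orders_le_power)
  also have "n ^ card S \<le> n ^ n"
    using \<open>card S \<le> n\<close> by (cases "n = 0") (auto intro: power_increasing)
  finally show "num_orders (removable d (\<lambda>_ _. 0)) S \<le> n ^ n" .
qed

lemma achievable_distinct_first:
  assumes "d \<ge> 1" "achievable d n B"
  obtains p where "inj_on (\<lambda>j. p j 0) {..<n}" "\<And>S. S \<subseteq> {..<n} \<Longrightarrow> num_orders (removable d p) S \<le> B"
proof -
  obtain p where p: "\<And>S. S \<subseteq> {..<n} \<Longrightarrow> num_orders (removable d p) S \<le> B"
    using assms(2) unfolding achievable_def by blast
  obtain \<eta> where \<eta>: "\<eta> > 0" "\<And>p' R x. \<forall>y\<in>{..<n}. \<forall>i<d. \<bar>p' y i - p y i\<bar> < \<eta> \<Longrightarrow>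
      R \<subseteq> {..<n} \<Longrightarrow> x \<in> R \<Longrightarrow> removable d p' R x \<Longrightarrow> removable d p R x"
    using removable_stable[OF finite_lessThan, of _ d p] by blast
  obtain f where f: "inj_on (\<lambda>j. Poly_Mapping.lookup (f j) 0) {..<n}"
      "\<And>j i. j < n \<Longrightarrow> i < d \<Longrightarrow> \<bar>Poly_Mapping.lookup (f j) i - p j i\<bar> < \<eta>"
    using general_position_near[OF assms(1) \<eta>(1)] by metis
  let ?p = "\<lambda>j. Poly_Mapping.lookup (f j)"
  have "num_orders (removable d ?p) S \<le> B" if S: "S \<subseteq> {..<n}" for S
  proof -
    have "num_orders (removable d ?p) S \<le> num_orders (removable d p) (id ` S)"
    proof (rule num_orders_transfer)
      show "finite S" using S finite_subset by blast
      fix R x assume "R \<subseteq> S" "x \<in> R" "removable d ?p R x"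
      then show "removable d p (id ` R) (id x)"
        using S f(2) by (auto intro!: \<eta>(2)[of ?p])
    qed simp
    also have "\<dots> \<le> B" using p[OF S] by simp
    finally show ?thesis .
  qed
  then show ?thesis using that[of ?p] f(1) by blast
qed

text \<open>
  On an arm, \<open>P\<close> is the image of \<open>p\<close> under the affine map
  \<open>z \<mapsto> (z\<^sub>0 + c) w + \<delta> z\<close>. The functional \<open>b\<close> below is the pullback of \<open>a\<close>
  under its linear part, and the condition on \<open>w 0 + \<delta>\<close> makes this linear part injective.
\<close>

lemma removable_affine_image:
  fixes p P :: "nat \<Rightarrow> nat \<Rightarrow> real"
  assumes "d \<ge> 1" "0 < \<delta>" "w 0 + \<delta> \<noteq> 0"
    and P: "\<And>x i. x \<in> R \<Longrightarrow> i < d \<Longrightarrow> P x i = (p (f x) 0 + c) * w i + \<delta> * p (f x) i"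
    and "x \<in> R" "removable d P R x"
  shows "removable d p (f ` R) (f x)"
proof -
  obtain a where a: "\<exists>i<d. a i \<noteq> 0" "\<And>y. y \<in> R \<Longrightarrow> dot d a (P y) \<le> dot d a (P x)"
    using assms(6) unfolding removable_def by blast
  define b where "b i = (if i = 0 then dot d a w else 0) + \<delta> * a i" for i
  have dot_b: "dot d b (p (f y)) = dot d a (P y) - c * dot d a w" if "y \<in> R" for y
  proof -
    have "dot d a (P y) = (\<Sum>i<d. a i * ((p (f y) 0 + c) * w i + \<delta> * p (f y) i))"
      using P[OF that] by (simp add: dot_def)
    also have "\<dots> = (p (f y) 0 + c) * dot d a w + \<delta> * dot d a (p (f y))"
      by (simp add: dot_def algebra_simps sum.distrib sum_distrib_left)
    finally have 1: "dot d a (P y) = (p (f y) 0 + c) * dot d a w + \<delta> * dot d a (p (f y))" .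
    have "dot d b (p (f y))
        = (\<Sum>i<d. (if i = 0 then dot d a w * p (f y) i else 0) + \<delta> * (a i * p (f y) i))"
      unfolding dot_def[of d b] b_def by (intro sum.cong) (auto simp: algebra_simps)
    also have "\<dots> = (\<Sum>i<d. (if i = 0 then dot d a w * p (f y) i else 0)) + \<delta> * dot d a (p (f y))"
      by (simp only: sum.distrib sum_distrib_left[symmetric] dot_def[symmetric])
    also have "(\<Sum>i<d. (if i = 0 then dot d a w * p (f y) i else 0)) = dot d a w * p (f y) 0"
      using assms(1) by simp
    finally show ?thesis using 1 by (simp add: algebra_simps)
  qed
  have "\<exists>i<d. b i \<noteq> 0"
  proof (rule ccontr)
    assume b: "\<not> (\<exists>i<d. b i \<noteq> 0)"
    have a0: "a i = 0" if "i < d" "i \<noteq> 0" for i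
      using b that assms(2) by (force simp: b_def)
    have "dot d a w = a 0 * w 0 + (\<Sum>i\<in>{..<d}-{0}. a i * w i)"
      unfolding dot_def using assms(1) by (intro sum.remove) auto
    also have "\<dots> = a 0 * w 0" using a0 by simp
    finally have "a 0 * (w 0 + \<delta>) = b 0"
      by (simp add: b_def algebra_simps)
    then have "a 0 = 0" using b assms(1,3) by auto
    then show False using a(1) a0 by metis
  qed
  moreover have "\<forall>y\<in>f ` R. dot d b (p y) \<le> dot d b (p (f x))"
    using a(2) dot_b assms(5) by auto
  ultimately show ?thesis
    unfolding removable_def by blast
qed

text \<open>
  There are so many nonempty arms that a nonzero functional is positive on the ray of one of them. If
  it is maximal at \<open>x\<close>, then it is
  positive at \<open>x\<close>, hence on the ray of \<open>x\<close>, and it increases from \<open>x\<close> outwards.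
\<close>

lemma inner_not_removable:
  fixes u :: "'a \<Rightarrow> real"
  assumes "arm ` R \<subseteq> {..<2 * h}" "card (arm ` R) > h + d"
    and u: "\<And>z. z \<in> R \<Longrightarrow> u z > 0"
    and P: "\<And>z i. P z i = u z * ray (arm z) i"
    and y: "y \<in> R" "arm y = arm x" "u x < u y" and "x \<in> R"
  shows "\<not> removable d P R x"
proof
  assume "removable d P R x"
  then obtain a where a: "\<exists>i<d. a i \<noteq> 0" "\<And>y. y \<in> R \<Longrightarrow> dot d a (P y) \<le> dot d a (P x)"
    unfolding removable_def by blast
  have dot_P: "dot d a (P z) = u z * dot d a (ray (arm z))" for z
    by (simp add: dot_def P sum_distrib_left mult_ac)
  have "\<not> arm ` R \<subseteq> {i. i < 2 * h \<and> dot d a (ray i) \<le> 0}"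
  proof
    assume "arm ` R \<subseteq> {i. i < 2 * h \<and> dot d a (ray i) \<le> 0}"
    then have "card (arm ` R) \<le> card {i. i < 2 * h \<and> dot d a (ray i) \<le> 0}"
      by (intro card_mono) auto
    then show False
      using card_ray_nonpos[OF a(1), of h] assms(2) by simp
  qed
  then obtain z where z: "z \<in> R" "dot d a (ray (arm z)) > 0"
    using assms(1) by force
  then have "0 < u z * dot d a (ray (arm z))"
    using u by simp
  also have "\<dots> \<le> u x * dot d a (ray (arm x))"
    using a(2)[OF z(1)] by (simp add: dot_P)
  finally have "dot d a (ray (arm x)) > 0"
    using u[OF \<open>x \<in> R\<close>] by (simp add: zero_less_mult_iff)
  then have "dot d a (P x) < dot d a (P y)"
    using y by (simp add: dot_P)
  then show False using a(2)[OF y(1)] by simp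
qed

text \<open>
  Point \<open>k\<close> belongs to arm \<open>k div m\<close> and is the copy of point \<open>k mod m\<close> of the given configuration.
  Its position on the ray is the first coordinate \<open>p (k mod m) 0\<close>, shifted by \<open>c\<close> to be positive;
  the distinctness of these coordinates tells inner from outer points. The configuration \<open>P0\<close>
  of the points exactly on the rays settles the first phase, and this persists when \<open>\<delta>\<close> times
  the given configuration is added, which makes each arm an injective affine image of it.
\<close>

lemma achievable_arms:
  assumes "d \<ge> 1" "achievable d m B" "B \<ge> 1"
  shows "achievable d (2 * h * m) ((2 * h) ^ (2 * h * m) * B ^ (h + d))"
proof -
  let ?n = "2 * h * m"
  obtain p where inj: "inj_on (\<lambda>j. p j 0) {..<m}"
    and p: "\<And>S. S \<subseteq> {..<m} \<Longrightarrow> num_orders (removable d p) S \<le> B"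
    using achievable_distinct_first[OF assms(1,2)] by blast
  define c where "c = 1 + (\<Sum>j<m. \<bar>p j 0\<bar>)"
  have u_pos: "p j 0 + c > 0" if "j < m" for j
    using member_le_sum[of j "{..<m}" "\<lambda>j. \<bar>p j 0\<bar>"] that by (simp add: c_def abs_le_iff)
  define u where "u k = p (k mod m) 0 + c" for k
  define arm where "arm k = k div m" for k
  have mod_less: "k mod m < m" and arm_less: "arm k < 2 * h" if "k < ?n" for k
  proof -
    have "m > 0" using that by (cases m) auto
    then show "k mod m < m" by simp
    show "arm k < 2 * h" using that by (simp add: arm_def less_mult_imp_div_less)
  qed
  have inj_arm: "k mod m = l mod m \<Longrightarrow> arm k = arm l \<Longrightarrow> k = l" for k l
    unfolding arm_def by (metis div_mult_mod_eq)
  define P0 where "P0 k i = u k * ray (arm k) i" for k i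
  obtain \<eta> where \<eta>: "\<eta> > 0" "\<And>p' R x. \<forall>y\<in>{..<?n}. \<forall>i<d. \<bar>p' y i - P0 y i\<bar> < \<eta> \<Longrightarrow>
      R \<subseteq> {..<?n} \<Longrightarrow> x \<in> R \<Longrightarrow> removable d p' R x \<Longrightarrow> removable d P0 R x"
    using removable_stable[OF finite_lessThan, of _ d P0] by blast
  have "\<forall>\<^sub>F \<delta> in at_right (0::real). \<forall>(j, i)\<in>{..<m} \<times> {..<d}. \<bar>\<delta> * p j i\<bar> < \<eta>"
  proof (rule eventually_ball_finite, safe)
    fix j i
    show "\<forall>\<^sub>F \<delta> in at_right (0::real). \<bar>\<delta> * p j i\<bar> < \<eta>"
      using \<eta>(1) by (intro order_tendstoD(2)[of _ 0]) (auto intro!: tendsto_eq_intros)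
  qed auto
  moreover have "\<forall>\<^sub>F \<delta> in at_right (0::real). \<delta> \<in> {0<..<1}"
    by (rule eventually_at_right_real) simp
  ultimately have "\<forall>\<^sub>F \<delta> in at_right (0::real). (\<forall>(j, i)\<in>{..<m} \<times> {..<d}. \<bar>\<delta> * p j i\<bar> < \<eta>) \<and> \<delta> \<in> {0<..<1}"
    by (rule eventually_conj)
  from eventually_happens'[OF trivial_limit_at_right_real this]
  obtain \<delta> where \<delta>: "0 < \<delta>" "\<delta> < 1" "\<And>j i. j < m \<Longrightarrow> i < d \<Longrightarrow> \<bar>\<delta> * p j i\<bar> < \<eta>"
    by auto
  define P where "P k i = P0 k i + \<delta> * p (k mod m) i" for k i
  have stable: "removable d P0 R x" if "R \<subseteq> {..<?n}" "x \<in> R" "removable d P R x" for R x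
    using that \<delta>(3) mod_less by (intro \<eta>(2)[of P]) (auto simp: P_def)
  have "num_orders (removable d P) S \<le> (2 * h) ^ ?n * B ^ (h + d)" if S: "S \<subseteq> {..<?n}" for S
  proof -
    have "finite S" using S finite_subset by blast
    then have "num_orders (removable d P) S \<le> (2 * h) ^ card S * B ^ (h + d)"
    proof (rule num_orders_le_arms[where arm = arm])
      show "arm ` S \<subseteq> {..<2 * h}" using S arm_less by auto
      show "B \<ge> 1" by fact
      show "removable d P T x" if "T \<subseteq> R" "removable d P R x" for R T x
        using that by (rule removable_antimono[rotated])
      show "num_orders (removable d P) T \<le> B" if T: "T \<subseteq> {x \<in> S. arm x = i}" for i T
      proof -
        have "num_orders (removable d P) T \<le> num_orders (removable d p) ((\<lambda>k. k mod m) ` T)"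
        proof (rule num_orders_transfer)
          show "finite T" using T \<open>finite S\<close> by (auto intro: finite_subset)
          show "inj_on (\<lambda>k. k mod m) T"
            by (rule inj_onI, rule inj_arm) (use T in auto)
          fix R x assume R: "R \<subseteq> T" "x \<in> R" "removable d P R x"
          have "ray i 0 + \<delta> \<noteq> 0"
            using \<delta> by (cases "even i") (auto simp: ray_def)
          moreover have "P y l = (p (y mod m) 0 + c) * ray i l + \<delta> * p (y mod m) l" if "y \<in> R" for y l
            using that R(1) T by (auto simp: P_def P0_def u_def)
          ultimately show "removable d p ((\<lambda>k. k mod m) ` R) (x mod m)"
            using R assms(1) \<delta>(1) by (intro removable_affine_image[where w = "ray i" and P = P and c = c and \<delta> = \<delta>]) auto
        qed
        also have "\<dots> \<le> B"
          using T S mod_less by (intro p) auto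
        finally show ?thesis .
      qed
      show "x = y" if R: "R \<subseteq> S" "h + d < card (arm ` R)" and xy: "x \<in> R" "y \<in> R"
        "removable d P R x" "removable d P R y" "arm x = arm y" for R x y
      proof (rule ccontr)
        assume "x \<noteq> y"
        have Rn: "R \<subseteq> {..<?n}" using R S by auto
        then have "x mod m < m" "y mod m < m" using xy mod_less by auto
        moreover have "x mod m \<noteq> y mod m" using \<open>x \<noteq> y\<close> xy inj_arm by blast
        ultimately have "u x \<noteq> u y"
          using inj by (auto simp: u_def inj_on_def)
        have inner: "\<not> removable d P0 R z" if "z \<in> R" "z' \<in> R" "arm z' = arm z" "u z < u z'" for z z'
        proof (rule inner_not_removable[where arm = arm and h = h and u = u])
          show "arm ` R \<subseteq> {..<2 * h}" using Rn arm_less by auto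
          show "u z > 0" if "z \<in> R" for z
            using that Rn mod_less u_pos by (auto simp: u_def)
        qed (use that R(2) in \<open>auto simp: P0_def\<close>)
        then show False
          using \<open>u x \<noteq> u y\<close> xy stable[OF Rn] by (metis linorder_neqE)
      qed
    qed
    also have "\<dots> \<le> (2 * h) ^ ?n * B ^ (h + d)"
    proof (cases "h = 0")
      case True
      then show ?thesis using S by simp
    next
      case False
      have "card S \<le> ?n" using S card_mono[OF _ S] by simp
      then show ?thesis using False by (intro mult_right_mono power_increasing) auto
    qed
    finally show ?thesis .
  qed
  then show ?thesis
    unfolding achievable_def by blast
qed

lemma min_peelings_le:
  assumes "d \<ge> 1" "achievable d n B"
  shows "min_peelings d n \<le> B"
proof -
  obtain p where p: "\<And>S. S \<subseteq> {..<n} \<Longrightarrow> num_orders (removable d p) S \<le> B"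
    using assms(2) unfolding achievable_def by blast
  obtain \<eta> where \<eta>: "\<eta> > 0" "\<And>p' R x. \<forall>y\<in>{..<n}. \<forall>i<d. \<bar>p' y i - p y i\<bar> < \<eta> \<Longrightarrow>
      R \<subseteq> {..<n} \<Longrightarrow> x \<in> R \<Longrightarrow> removable d p' R x \<Longrightarrow> removable d p R x"
    using removable_stable[OF finite_lessThan, of _ d p] by blast
  obtain f where f: "inj_on (\<lambda>j. Poly_Mapping.lookup (f j) 0) {..<n}"
      "general_position d (f ` {..<n})"
      "\<And>j i. j < n \<Longrightarrow> i < d \<Longrightarrow> \<bar>Poly_Mapping.lookup (f j) i - p j i\<bar> < \<eta>"
    using general_position_near[OF assms(1) \<eta>(1)] by metis
  let ?P = "f ` {..<n}" and ?g = "inv_into {..<n} f"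
  have inj: "inj_on f {..<n}"
    using f(1) by (auto simp: inj_on_def)
  have "num_peelings ?P \<le> num_orders (\<lambda>R x. x extreme_point_of (convex hull R)) ?P"
    by (rule num_peelings_le_orders) simp
  also have "\<dots> \<le> num_orders (removable d p) (?g ` ?P)"
  proof (rule num_orders_transfer)
    fix R x assume R: "R \<subseteq> ?P" "x \<in> R" "x extreme_point_of (convex hull R)"
    have fg: "f (?g y) = y" "?g y < n" if "y \<in> R" for y
      using that R(1) by (auto simp: f_inv_into_f inv_into_into[of _ f "{..<n}", simplified])
    have "removable d Poly_Mapping.lookup R x"
      using R f(2) assms(1)
      by (intro extreme_point_removable) (auto simp: general_position_def intro: finite_subset)
    then have "removable d (\<lambda>j. Poly_Mapping.lookup (f j)) (?g ` R) (?g x)"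
      using R(2) fg by (simp add: removable_def)
    then show "removable d p (?g ` R) (?g x)"
      using R(2) fg f(3) by (intro \<eta>(2)[of "\<lambda>j. Poly_Mapping.lookup (f j)"]) auto
  qed (auto simp: inj_on_inv_into)
  also have "\<dots> \<le> B"
    using inj by (intro p) auto
  finally have "num_peelings ?P \<le> B" .
  moreover have "card ?P = n"
    using inj by (simp add: card_image)
  ultimately show ?thesis
    unfolding min_peelings_def using f(2)
    by (intro cInf_lower2[of "num_peelings ?P"]) auto
qed

section \<open>The growth rate\<close>

definition growth :: "nat \<Rightarrow> real \<Rightarrow> bool" where
  "growth d a \<longleftrightarrow> (\<exists>C\<ge>1. \<forall>n. \<exists>B\<ge>1. achievable d n B \<and> real B \<le> C * exp (a * real n))"

lemma growth_mono:
  assumes "growth d a" "a \<le> b"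
  shows "growth d b"
proof -
  obtain C where C: "C \<ge> 1" "\<And>n. \<exists>B\<ge>1. achievable d n B \<and> real B \<le> C * exp (a * real n)"
    using assms(1) unfolding growth_def by blast
  have le: "C * exp (a * real n) \<le> C * exp (b * real n)" for n
    using C(1) assms(2) by (auto intro!: mult_right_mono)
  show ?thesis
    unfolding growth_def
  proof (intro exI[of _ C] conjI allI)
    fix n
    show "\<exists>B\<ge>1. achievable d n B \<and> real B \<le> C * exp (b * real n)"
      using C(2)[of n] le[of n] by (meson order_trans)
  qed (rule C(1))
qed

lemma next_multiple_bounds:
  fixes n q :: nat
  assumes "q > 0"
  shows "n \<le> q * (n div q + 1)" "q * (n div q + 1) \<le> n + q"
proof -
  have "n = q * (n div q) + n mod q" "n mod q < q"
    using assms by simp_all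
  then show "n \<le> q * (n div q + 1)" "q * (n div q + 1) \<le> n + q"
    unfolding distrib_left mult_1_right by linarith+
qed

text \<open>
  Some exponential bound is needed before the rate can be improved. Since \<open>E / q \<le> 3/4\<close>, one step of
  the recursion for \<open>n \<ge> 6q = 12h\<close> turns the bound \<open>A\<^sup>m\<close> into at most
  \<open>q\<^sup>2\<^sup>n A\<^sup>7\<^sup>n\<^sup>/\<^sup>8\<close>, which is below \<open>A\<^sup>n\<close> for \<open>A = (6q)\<^sup>1\<^sup>6\<close>. For smaller \<open>n\<close> the trivial bound
  \<open>n\<^sup>n\<close> suffices.
\<close>

lemma growth_start:
  assumes "d \<ge> 1" "h \<ge> 1" "2 * d \<le> h"
  shows "\<exists>a\<ge>0. growth d a"
proof -
  let ?X = "12 * h"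
  have ach: "achievable d n ((?X ^ 16) ^ n)" for n
  proof (induction n rule: less_induct)
    case (less n)
    show ?case
    proof (cases "n < ?X")
      case True
      have "n ^ n \<le> (?X ^ 16) ^ n"
        using True self_le_power[of ?X 16] assms(2) by (intro power_mono) auto
      then show ?thesis
        using achievable_self_power achievable_mono by blast
    next
      case False
      define m where "m = n div (2 * h) + 1"
      have n_le: "n \<le> 2 * h * m" and le_n: "2 * h * m \<le> n + 2 * h"
        using next_multiple_bounds[of "2 * h" n] assms(2) by (auto simp: m_def)
      have "m < n"
      proof -
        have "2 * m \<le> 2 * h * m" using assms(2) by simp
        then show ?thesis using le_n False assms(2) by linarith
      qed
      have "achievable d (2 * h * m) ((2 * h) ^ (2 * h * m) * ((?X ^ 16) ^ m) ^ (h + d))"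
        using less.IH[OF \<open>m < n\<close>] assms by (intro achievable_arms) auto
      moreover have "(2 * h) ^ (2 * h * m) * ((?X ^ 16) ^ m) ^ (h + d) \<le> (?X ^ 16) ^ n"
      proof -
        have "2 * h * m \<le> 2 * n" using le_n False by linarith
        have "2 * (h + d) * m \<le> 3 * h * m" using assms(3) by (intro mult_right_mono) auto
        then have "16 * (m * (h + d)) \<le> 12 * (2 * h * m)" by (simp add: algebra_simps)
        also have "\<dots> \<le> 14 * n" using le_n False by linarith
        finally have "16 * (m * (h + d)) \<le> 14 * n" .
        have "(2 * h) ^ (2 * h * m) \<le> ?X ^ (2 * h * m)"
          by (intro power_mono) auto
        also have "\<dots> \<le> ?X ^ (2 * n)"
          using \<open>2 * h * m \<le> 2 * n\<close> assms(2) by (intro power_increasing) auto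
        finally have "(2 * h) ^ (2 * h * m) * ((?X ^ 16) ^ m) ^ (h + d)
            \<le> ?X ^ (2 * n) * ((?X ^ 16) ^ m) ^ (h + d)"
          by (rule mult_right_mono) simp
        also have "\<dots> = ?X ^ (2 * n) * ?X ^ (16 * (m * (h + d)))"
          by (simp only: power_mult)
        also have "\<dots> \<le> ?X ^ (2 * n) * ?X ^ (14 * n)"
          using \<open>16 * (m * (h + d)) \<le> 14 * n\<close> assms(2) by (intro mult_left_mono power_increasing) auto
        also have "\<dots> = (?X ^ 16) ^ n"
          by (simp only: power_add[symmetric] power_mult[symmetric]) simp
        finally show ?thesis .
      qed
      ultimately show ?thesis
        using n_le achievable_mono by blast
    qed
  qed
  have "growth d (ln (real (?X ^ 16)))"
    unfolding growth_def
  proof (intro exI[of _ "1 :: real"] conjI allI)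
    fix n
    have "real ((?X ^ 16) ^ n) = exp (ln (real (?X ^ 16)) * real n)"
      using assms(2) by (subst mult.commute, subst exp_of_nat_mult) simp
    then show "\<exists>B\<ge>1. achievable d n B \<and> real B \<le> 1 * exp (ln (real (?X ^ 16)) * real n)"
      using ach[of n] assms(2) by (intro exI[of _ "(?X ^ 16) ^ n"]) auto
  qed simp
  moreover have "ln (real (?X ^ 16)) \<ge> 0"
  proof (rule ln_ge_zero)
    have "1 \<le> ?X ^ 16" using assms(2) by (intro one_le_power) simp
    then have "real 1 \<le> real (?X ^ 16)" by (rule of_nat_mono)
    then show "1 \<le> real (?X ^ 16)" by (simp only: of_nat_1)
  qed
  ultimately show ?thesis by blast
qed

text \<open>
  Rounding \<open>n\<close> up to a multiple of \<open>2h\<close> costs only a constant factor. This factor grows with each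
  application, which is harmless for finitely many of them; a single induction on \<open>n\<close> would not
  leave it constant.
\<close>

lemma growth_step:
  assumes "d \<ge> 1" "h \<ge> 1" "growth d a" "a \<ge> 0"
  shows "growth d (ln (2 * real h) + (real h + real d) / (2 * real h) * a)"
proof -
  let ?L = "ln (2 * real h)" and ?q = "2 * real h" and ?E = "real h + real d"
  obtain C where C: "C \<ge> 1" "\<And>n. \<exists>B\<ge>1. achievable d n B \<and> real B \<le> C * exp (a * real n)"
    using assms(3) unfolding growth_def by blast
  have "?L \<ge> 0" using assms(2) by simp
  define C' where "C' = exp (?q * ?L) * C ^ (h + d) * exp (?E * a)"
  show ?thesis
    unfolding growth_def
  proof (intro exI[of _ C'] conjI allI)
    have "1 \<le> exp (?q * ?L)" "1 \<le> exp (?E * a)"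
      using \<open>?L \<ge> 0\<close> assms(4) by auto
    moreover have "1 \<le> C ^ (h + d)"
      using C(1) by (rule one_le_power)
    ultimately show "C' \<ge> 1"
      unfolding C'_def by (metis mult_ge1_I)
    fix n
    define m where "m = n div (2 * h) + 1"
    obtain B where B: "B \<ge> 1" "achievable d m B" "real B \<le> C * exp (a * real m)"
      using C(2) by blast
    define B' where "B' = (2 * h) ^ (2 * h * m) * B ^ (h + d)"
    have n_le: "n \<le> 2 * h * m" and "2 * h * m \<le> n + 2 * h"
      using next_multiple_bounds[of "2 * h" n] assms(2) by (auto simp: m_def)
    then have le_n: "?q * real m \<le> real n + ?q"
      by (metis (mono_tags) of_nat_add of_nat_le_iff of_nat_mult of_nat_numeral)
    then have m_le: "real m \<le> real n / ?q + 1"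
      using assms(2) by (simp add: field_simps)
    have "achievable d n B'"
      unfolding B'_def using achievable_arms[OF assms(1) B(2,1)] n_le by (rule achievable_mono) simp
    moreover have "B' \<ge> 1"
      unfolding B'_def using B(1) assms(2) by simp
    moreover have "real B' \<le> C' * exp ((?L + ?E / ?q * a) * real n)"
    proof -
      have "real ((2 * h) ^ (2 * h * m)) = exp (?L) ^ (2 * h * m)"
        using assms(2) by simp
      also have "\<dots> = exp (?q * real m * ?L)"
        by (simp add: exp_of_nat_mult[symmetric])
      also have "\<dots> \<le> exp ((real n + ?q) * ?L)"
        using le_n \<open>?L \<ge> 0\<close> by (simp add: mult_right_mono)
      finally have 1: "real ((2 * h) ^ (2 * h * m)) \<le> exp ((real n + ?q) * ?L)" .
      have "real (B ^ (h + d)) \<le> (C * exp (a * real m)) ^ (h + d)"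
        using B(3) by (simp add: power_mono)
      also have "\<dots> = C ^ (h + d) * exp (?E * (a * real m))"
        by (simp add: power_mult_distrib exp_of_nat_mult[symmetric])
      also have "\<dots> \<le> C ^ (h + d) * exp (?E * (a * (real n / ?q + 1)))"
        using m_le assms(4) C(1) by (auto intro!: mult_left_mono)
      finally have 2: "real (B ^ (h + d)) \<le> C ^ (h + d) * exp (?E * (a * (real n / ?q + 1)))" .
      have "real B' = real ((2 * h) ^ (2 * h * m)) * real (B ^ (h + d))"
        by (simp add: B'_def)
      also have "\<dots> \<le> exp ((real n + ?q) * ?L) * (C ^ (h + d) * exp (?E * (a * (real n / ?q + 1))))"
        by (intro mult_mono 1 2) auto
      also have "\<dots> = C ^ (h + d) * exp ((real n + ?q) * ?L + ?E * (a * (real n / ?q + 1)))"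
        by (simp add: exp_add)
      also have "(real n + ?q) * ?L + ?E * (a * (real n / ?q + 1))
          = ?q * ?L + ?E * a + (?L + ?E / ?q * a) * real n"
        by (simp add: algebra_simps add_divide_distrib)
      also have "C ^ (h + d) * exp \<dots> = C' * exp ((?L + ?E / ?q * a) * real n)"
        by (simp add: C'_def exp_add)
      finally show ?thesis .
    qed
    ultimately show "\<exists>B\<ge>1. achievable d n B \<and> real B \<le> C' * exp ((?L + ?E / ?q * a) * real n)"
      by blast
  qed
qed

text \<open>
  The map \<open>a \<mapsto> L + \<theta> a\<close> contracts by \<open>\<theta>\<close> towards \<open>l = L / (1 - \<theta>)\<close>, so finitely many
  steps lead from the initial rate below any \<open>b > l\<close>.
\<close>

lemma growth_above_fixpoint:
  assumes "d \<ge> 1" "h \<ge> 1" "2 * d \<le> h" and b: "ln (2 * real h) < (1 - (real h + real d) / (2 * real h)) * b"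
  shows "growth d b"
proof -
  define \<theta> where "\<theta> = (real h + real d) / (2 * real h)"
  define L where "L = ln (2 * real h)"
  have \<theta>: "0 \<le> \<theta>" "\<theta> < 1"
    using assms(2,3) by (auto simp: \<theta>_def field_simps)
  have "L \<ge> 0" using assms(2) by (simp add: L_def)
  define l where "l = L / (1 - \<theta>)"
  have l: "l \<ge> 0" "l < b" "L = l - \<theta> * l"
  proof -
    have "L < (1 - \<theta>) * b" using b by (simp only: L_def \<theta>_def)
    then show "l < b" using \<theta> by (simp add: l_def pos_divide_less_eq mult.commute)
    show "l \<ge> 0" using \<theta> \<open>L \<ge> 0\<close> by (simp add: l_def)
    have "l * (1 - \<theta>) = L" using \<theta> by (simp add: l_def)
    then show "L = l - \<theta> * l" by (simp add: algebra_simps)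
  qed
  obtain a where a: "a \<ge> 0" "growth d a"
    using growth_start[OF assms(1-3)] by blast
  have iter: "growth d (l + \<theta> ^ k * a)" for k
  proof (induction k)
    case 0
    show ?case using growth_mono[OF a(2)] l(1) by simp
  next
    case (Suc k)
    have "growth d (L + \<theta> * (l + \<theta> ^ k * a))"
      unfolding L_def \<theta>_def
      by (rule growth_step[OF assms(1,2)]) (use Suc l(1) a(1) \<theta>(1) in \<open>auto simp: \<theta>_def[symmetric]\<close>)
    then show ?case by (simp add: l(3) algebra_simps)
  qed
  have "(\<lambda>k. l + \<theta> ^ k * a) \<longlonglongrightarrow> l + 0 * a"
    using \<theta> by (intro tendsto_intros LIMSEQ_power_zero) auto
  then have "\<forall>\<^sub>F k in sequentially. l + \<theta> ^ k * a < b"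
    using l(2) by (intro order_tendstoD(2)[of _ l]) auto
  then obtain k where "l + \<theta> ^ k * a < b"
    using eventually_happens'[OF sequentially_bot] by blast
  then show ?thesis
    using growth_mono[OF iter] by (meson less_imp_le)
qed

theorem corollary3:
  fixes \<epsilon> :: real
  assumes "\<epsilon> > 0"
  shows "\<exists>D :: real. \<forall>d :: nat. real d \<ge> D \<longrightarrow>
    (\<lambda>n :: nat. real (min_peelings d n)) \<in> O(\<lambda>n. real d powr ((2 + \<epsilon>) * real n))"
proof -
  \<comment> \<open>then \<open>2K / (K - 1) < 2 + \<epsilon>\<close>, and \<open>D\<close> absorbs the summand \<open>ln (2K)\<close> of \<open>ln q\<close>\<close>
  obtain K :: nat where K: "real K \<ge> 2 + 4 / \<epsilon>"
    using real_arch_simple by blast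
  have "4 / \<epsilon> > 0" using assms by simp
  then have K2: "real K > 2" using K by linarith
  define \<theta> where "\<theta> = (real K + 1) / (2 * real K)"
  have "(1 - \<theta>) * (2 + \<epsilon>) > 1"
  proof -
    have "\<epsilon> * real K \<ge> 2 * \<epsilon> + 4"
      using K assms by (simp add: field_simps)
    then have "(real K - 1) * (2 + \<epsilon>) > 2 * real K"
      using assms by (simp add: algebra_simps)
    moreover have "(1 - \<theta>) * (2 + \<epsilon>) = (real K - 1) * (2 + \<epsilon>) / (2 * real K)"
      using K2 by (simp add: \<theta>_def field_simps)
    ultimately show ?thesis using K2 by simp
  qed
  then have gain: "(1 - \<theta>) * (2 + \<epsilon>) - 1 > 0" by simp
  define D where "D = 1 + exp (ln (2 * real K) / ((1 - \<theta>) * (2 + \<epsilon>) - 1))"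
  show ?thesis
  proof (intro exI[of _ D] allI impI)
    fix d :: nat assume "real d \<ge> D"
    then have d: "real d > exp (ln (2 * real K) / ((1 - \<theta>) * (2 + \<epsilon>) - 1))" "real d > 1"
      unfolding D_def by (smt (verit) exp_gt_zero)+
    have "ln (2 * real K) / ((1 - \<theta>) * (2 + \<epsilon>) - 1) < ln (real d)"
      using d by (metis exp_gt_zero ln_exp ln_less_cancel_iff order_less_trans)
    then have "ln (2 * real K) < ((1 - \<theta>) * (2 + \<epsilon>) - 1) * ln (real d)"
      using gain by (simp add: pos_divide_less_eq mult.commute)
    moreover have "ln (2 * real (K * d)) = ln (2 * real K) + ln (real d)"
      using K2 d by (simp add: ln_mult)
    ultimately have "ln (2 * real (K * d)) < (1 - \<theta>) * ((2 + \<epsilon>) * ln (real d))"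
      by (simp add: algebra_simps)
    moreover have "\<theta> = (real (K * d) + real d) / (2 * real (K * d))"
      using K2 d by (simp add: \<theta>_def field_simps)
    ultimately have "growth d ((2 + \<epsilon>) * ln (real d))"
      using K2 d by (intro growth_above_fixpoint[of d "K * d"]) auto
    then obtain C where C: "C \<ge> 1"
      "\<And>n. \<exists>B\<ge>1. achievable d n B \<and> real B \<le> C * exp ((2 + \<epsilon>) * ln (real d) * real n)"
      unfolding growth_def by blast
    have "real (min_peelings d n) \<le> C * real d powr ((2 + \<epsilon>) * real n)" for n
    proof -
      obtain B where B: "achievable d n B" "real B \<le> C * exp ((2 + \<epsilon>) * ln (real d) * real n)"
        using C(2) by blast
      have "real (min_peelings d n) \<le> real B"
        using min_peelings_le[OF _ B(1)] d by simp
      also note B(2)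
      also have "exp ((2 + \<epsilon>) * ln (real d) * real n) = real d powr ((2 + \<epsilon>) * real n)"
        using d by (simp add: powr_def mult_ac)
      finally show ?thesis .
    qed
    then show "(\<lambda>n. real (min_peelings d n)) \<in> O(\<lambda>n. real d powr ((2 + \<epsilon>) * real n))"
      by (intro bigoI[of _ C] always_eventually) (auto simp: abs_of_nonneg)
  qed
qed

end
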